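(* For all integers $n\ge 0$, $$\mathrm{cp}_{1,1,1}(n)=\sum_{k=0}^n p(k).$$
   Context: A partition of a non-negative integer $n$ is a finite multiset of positive integers (its parts) with sum $n$; the empty multiset is the unique partition of $0$. $p(n)$ is the number of partitions of $n$, so $p(0)=1$. The size $|\lambda|$ of a partition is the sum of its parts. A $(1,1,1)$-copartition is a triple of partitions $(\gamma,\rho,\sigma)$, with $\gamma$ and $\sigma$ arbitrary (possibly empty) partitions, such that $\rho$ has the same number of parts as $\sigma$, each of which has size equal to the number of parts of $\gamma$ (if $\gamma$ is empty, $\rho$ is regarded as empty). Its size is $|\gamma|+|\rho|+|\sigma|$, and $\mathrm{cp}_{1,1,1}(n)$ is the number of $(1,1,1)$-copartitions of size $n$. *)

theory Defs
  imports "HOL-Library.Multiset"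
begin

definition partition_of :: "nat \<Rightarrow> nat multiset \<Rightarrow> bool" where
  "partition_of n \<pi> \<longleftrightarrow> (\<forall>i \<in># \<pi>. 0 < i) \<and> sum_mset \<pi> = n"

definition is_partition :: "nat multiset \<Rightarrow> bool" where
  "is_partition \<pi> \<longleftrightarrow> (\<exists>n. partition_of n \<pi>)"

(* There are only finitely many partitions of n, and likewise only finitely many copartitions
   of size n below, so card is the true count in both cases. *)
definition num_partitions :: "nat \<Rightarrow> nat" where
  "num_partitions n = card {\<pi>. partition_of n \<pi>}"

(* If \<gamma> is empty, the parts of \<rho> would have size 0; by convention \<rho> is then the empty partition,
   and \<sigma> remains arbitrary. *)
definition copartition111 :: "nat multiset \<times> nat multiset \<times> nat multiset \<Rightarrow> bool" where
  "copartition111 = (\<lambda>(\<gamma>, \<rho>, \<sigma>).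
     is_partition \<gamma> \<and> is_partition \<rho> \<and> is_partition \<sigma> \<and>
     (if \<gamma> = {#} then \<rho> = {#}
      else size \<rho> = size \<sigma> \<and> (\<forall>i \<in># \<rho>. i = size \<gamma>)))"

definition copartition_size :: "nat multiset \<times> nat multiset \<times> nat multiset \<Rightarrow> nat" where
  "copartition_size = (\<lambda>(\<gamma>, \<rho>, \<sigma>). sum_mset \<gamma> + sum_mset \<rho> + sum_mset \<sigma>)"

definition cp111 :: "nat \<Rightarrow> nat" where
  "cp111 n = card {c. copartition111 c \<and> copartition_size c = n}"

end

theory Submission
  imports Defs
begin

text \<open>
  In a copartition \<open>(\<gamma>, \<rho>, \<sigma>)\<close> the partition \<open>\<rho>\<close> is determined by \<open>\<gamma>\<close> and \<open>\<sigma>\<close> and contributes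
  the product of their numbers of parts to the size. Fix the number \<open>m\<close> of parts of \<open>\<gamma>\<close>. Adding
  \<open>m\<close> to every part of \<open>\<sigma>\<close> absorbs \<open>\<rho>\<close> and turns \<open>\<sigma>\<close> into an arbitrary partition all of whose parts
  exceed \<open>m\<close>. By conjugation, the partitions \<open>\<gamma>\<close> of \<open>j + m\<close> into \<open>m\<close> parts are equinumerous with the
  partitions of \<open>j\<close> into parts of size at most \<open>m\<close> (\<open>card_exact_eq_card_bounded\<close>); a common recurrence
  shows this without constructing conjugates. A partition of \<open>n - m\<close> splits uniquely into its parts
  at most \<open>m\<close> and its parts exceeding \<open>m\<close> (\<open>num_partitions_split\<close>), so the copartitions of size \<open>n\<close>
  with \<open>m\<close> parts in \<open>\<gamma>\<close> are counted by the number of partitions of \<open>n - m\<close>. It remains to sum over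
  \<open>m \<le> n\<close>.
\<close>

section \<open>Partitions with restricted number or size of parts\<close>

lemma finite_partitions: "finite {\<pi>. partition_of n \<pi>}"
proof (induction n rule: less_induct)
  case (less n)
  let ?U = "insert {#} (\<Union>i\<in>{1..n}. add_mset i ` {\<pi>. partition_of (n - i) \<pi>})"
  have "{\<pi>. partition_of n \<pi>} \<subseteq> ?U"
  proof
    fix \<pi> assume "\<pi> \<in> {\<pi>. partition_of n \<pi>}"
    then have \<pi>: "partition_of n \<pi>" by simp
    show "\<pi> \<in> ?U"
    proof (cases \<pi>)
      case (add i \<tau>)
      with \<pi> have "i \<in> {1..n}" "partition_of (n - i) \<tau>"
        by (auto simp: partition_of_def)
      with add show ?thesis by blast
    qed simp
  qed
  moreover have "finite ?U"
    using less by auto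
  ultimately show ?case by (rule finite_subset)
qed

text \<open>The partitions of \<open>j + m\<close> into exactly \<open>m\<close> parts. The shift by \<open>m\<close> is the least possible
  size, so that \<open>j\<close> ranges over all natural numbers.\<close>
definition exact_parts :: "nat \<Rightarrow> nat \<Rightarrow> nat multiset set" where
  "exact_parts m j = {\<gamma>. partition_of (j + m) \<gamma> \<and> size \<gamma> = m}"

text \<open>The partitions of \<open>j\<close> into parts of size at most \<open>m\<close>.\<close>
definition bounded_parts :: "nat \<Rightarrow> nat \<Rightarrow> nat multiset set" where
  "bounded_parts m j = {\<tau>. partition_of j \<tau> \<and> (\<forall>i\<in>#\<tau>. i \<le> m)}"

text \<open>The partitions whose size is \<open>l\<close> once every part is increased by \<open>m\<close>.\<close>
definition raised_parts :: "nat \<Rightarrow> nat \<Rightarrow> nat multiset set" where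
  "raised_parts m l = {\<sigma>. (\<forall>i\<in>#\<sigma>. 0 < i) \<and> sum_mset \<sigma> + m * size \<sigma> = l}"

lemma finite_exact_parts: "finite (exact_parts m j)"
  by (rule finite_subset[OF _ finite_partitions[of "j + m"]]) (auto simp: exact_parts_def)

lemma finite_bounded_parts: "finite (bounded_parts m j)"
  by (rule finite_subset[OF _ finite_partitions[of j]]) (auto simp: bounded_parts_def)

lemma finite_raised_parts: "finite (raised_parts m l)"
proof (rule finite_subset)
  show "raised_parts m l \<subseteq> (\<Union>k\<in>{..l}. {\<pi>. partition_of k \<pi>})"
    by (auto simp: raised_parts_def partition_of_def)
qed (simp add: finite_partitions)

lemma sum_mset_image_add: "sum_mset (image_mset ((+) m) \<sigma>) = sum_mset \<sigma> + m * size \<sigma>"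
  for m :: nat
  by (induction \<sigma>) auto

lemma image_mset_minus_plus: "\<forall>i\<in>#\<pi>. m \<le> i \<Longrightarrow> image_mset ((+) m) (image_mset (\<lambda>i. i - m) \<pi>) = \<pi>"
  for m :: nat
  by (induction \<pi>) auto

section \<open>The common recurrence behind conjugation\<close>

text \<open>A part equal to 1 is removed; if there is none, every part is decreased by 1.\<close>
lemma exact_parts_Suc:
  "exact_parts (Suc m) j = add_mset 1 ` exact_parts m j \<union>
     (if Suc m \<le> j then image_mset ((+) 1) ` exact_parts (Suc m) (j - Suc m) else {})"
  (is "_ = ?A \<union> ?B")
proof (intro subset_antisym subsetI)
  fix \<gamma> assume \<gamma>: "\<gamma> \<in> exact_parts (Suc m) j"
  show "\<gamma> \<in> ?A \<union> ?B"
  proof (cases "1 \<in># \<gamma>")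
    case True
    then obtain \<tau> where \<tau>: "\<gamma> = add_mset 1 \<tau>" by (blast dest: multi_member_split)
    with \<gamma> have "\<tau> \<in> exact_parts m j"
      by (auto simp: exact_parts_def partition_of_def)
    with \<tau> show ?thesis by blast
  next
    case False
    have ge: "2 \<le> i" if "i \<in># \<gamma>" for i
    proof -
      from \<gamma> that have "0 < i" by (auto simp: exact_parts_def partition_of_def)
      moreover from False that have "i \<noteq> 1" by blast
      ultimately show ?thesis by simp
    qed
    define \<tau> where "\<tau> = image_mset (\<lambda>i. i - 1) \<gamma>"
    have eq: "image_mset ((+) 1) \<tau> = \<gamma>"
      unfolding \<tau>_def by (rule image_mset_minus_plus) (use ge in fastforce)
    have size: "size \<tau> = Suc m"
      using \<gamma> by (simp add: \<tau>_def exact_parts_def)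
    have pos: "\<forall>i\<in>#\<tau>. 0 < i"
      using ge by (fastforce simp: \<tau>_def)
    have "sum_mset \<gamma> = sum_mset \<tau> + Suc m"
      using sum_mset_image_add[of 1 \<tau>] eq size by simp
    with \<gamma> have sum: "sum_mset \<tau> = j"
      by (simp add: exact_parts_def partition_of_def)
    have "size \<tau> \<le> sum_mset \<tau>"
      using pos by (induction \<tau>) auto
    with size sum have le: "Suc m \<le> j" by simp
    have "\<tau> \<in> exact_parts (Suc m) (j - Suc m)"
      using le size sum pos by (simp add: exact_parts_def partition_of_def)
    with le eq show ?thesis by (metis UnI2 image_eqI)
  qed
next
  fix \<gamma> assume "\<gamma> \<in> ?A \<union> ?B"
  then show "\<gamma> \<in> exact_parts (Suc m) j"
    using sum_mset_image_add[of 1]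
    by (auto simp: exact_parts_def partition_of_def split: if_splits)
qed

text \<open>A part equal to the bound is removed, if there is one.\<close>
lemma bounded_parts_Suc:
  "bounded_parts (Suc m) j = bounded_parts m j \<union>
     (if Suc m \<le> j then add_mset (Suc m) ` bounded_parts (Suc m) (j - Suc m) else {})"
  (is "_ = ?A \<union> ?B")
proof (intro subset_antisym subsetI)
  fix \<tau> assume \<tau>: "\<tau> \<in> bounded_parts (Suc m) j"
  show "\<tau> \<in> ?A \<union> ?B"
  proof (cases "Suc m \<in># \<tau>")
    case True
    then obtain \<pi> where \<pi>: "\<tau> = add_mset (Suc m) \<pi>" by (blast dest: multi_member_split)
    with \<tau> have "\<pi> \<in> bounded_parts (Suc m) (j - Suc m)" "Suc m \<le> j"
      by (auto simp: bounded_parts_def partition_of_def)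
    with \<pi> show ?thesis by simp
  next
    case False
    with \<tau> have "\<tau> \<in> bounded_parts m j"
      by (auto simp: bounded_parts_def le_Suc_eq)
    then show ?thesis ..
  qed
next
  fix \<tau> assume "\<tau> \<in> ?A \<union> ?B"
  then show "\<tau> \<in> bounded_parts (Suc m) j"
    by (auto simp: bounded_parts_def partition_of_def split: if_splits)
qed

lemma card_exact_eq_card_bounded: "card (exact_parts m j) = card (bounded_parts m j)"
proof (induction m arbitrary: j)
  case 0
  have "\<tau> = {#}" if "\<tau> \<in> bounded_parts 0 j" for \<tau>
    using that by (cases \<tau>) (auto simp: bounded_parts_def partition_of_def)
  then have "exact_parts 0 j = bounded_parts 0 j"
    by (auto simp: exact_parts_def bounded_parts_def)
  then show ?case by simp
next
  case (Suc m)
  show ?case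
  proof (induction j rule: less_induct)
    case (less j)
    let ?E = "if Suc m \<le> j then image_mset ((+) 1) ` exact_parts (Suc m) (j - Suc m) else {}"
    let ?B = "if Suc m \<le> j then add_mset (Suc m) ` bounded_parts (Suc m) (j - Suc m) else {}"
    have "1 \<notin># \<gamma>" if "\<gamma> \<in> ?E" for \<gamma>
      using that by (auto simp: exact_parts_def partition_of_def split: if_splits)
    then have "add_mset 1 ` exact_parts m j \<inter> ?E = {}"
      by fastforce
    then have "card (exact_parts (Suc m) j) = card (add_mset 1 ` exact_parts m j) + card ?E"
      unfolding exact_parts_Suc[of m j] by (intro card_Un_disjoint) (auto simp: finite_exact_parts)
    also have "card (add_mset 1 ` exact_parts m j) = card (exact_parts m j)"
      by (intro card_image inj_onI) simp
    also have "card ?E = (if Suc m \<le> j then card (exact_parts (Suc m) (j - Suc m)) else 0)"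
      by (auto intro!: card_image inj_on_subset[OF multiset.inj_map] simp: inj_def)
    also have "\<dots> = (if Suc m \<le> j then card (bounded_parts (Suc m) (j - Suc m)) else 0)"
      using less by simp
    also have "\<dots> = card ?B"
      by (simp add: card_image inj_on_def)
    also have "card (exact_parts m j) = card (bounded_parts m j)"
      by (rule Suc)
    also have "card (bounded_parts m j) + card ?B = card (bounded_parts (Suc m) j)"
      unfolding bounded_parts_Suc[of m j]
      by (intro card_Un_disjoint[symmetric])
        (auto simp: finite_bounded_parts, auto simp: bounded_parts_def)
    finally show ?case .
  qed
qed

section \<open>Splitting partitions and copartitions\<close>

lemma num_partitions_split:
  "num_partitions l = (\<Sum>j\<le>l. card (bounded_parts m j) * card (raised_parts m (l - j)))"
proof -
  let ?S = "SIGMA j:{..l}. bounded_parts m j \<times> raised_parts m (l - j)"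
  let ?f = "\<lambda>(j :: nat, \<tau>, \<sigma>). \<tau> + image_mset ((+) m) \<sigma>"
  let ?lo = "filter_mset (\<lambda>i. i \<le> m)" and ?hi = "filter_mset (\<lambda>i. \<not> i \<le> m)"
  let ?g = "\<lambda>\<pi>. (sum_mset (?lo \<pi>), ?lo \<pi>, image_mset (\<lambda>i. i - m) (?hi \<pi>))"
  have fg: "?f (?g \<pi>) = \<pi>" for \<pi>
    using image_mset_minus_plus[of "?hi \<pi>" m] by simp
  have "bij_betw ?f ?S {\<pi>. partition_of l \<pi>}"
  proof (rule bij_betw_byWitness[where f' = ?g])
    show "\<forall>s\<in>?S. ?g (?f s) = s"
    proof (clarify, goal_cases)
      case (1 j \<tau> \<sigma>)
      then have "?lo \<tau> = \<tau>" "?hi \<tau> = {#}" "sum_mset \<tau> = j"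
        by (auto simp: bounded_parts_def partition_of_def filter_mset_eq_conv)
      moreover from 1 have "?hi (image_mset ((+) m) \<sigma>) = image_mset ((+) m) \<sigma>"
        by (auto simp: raised_parts_def filter_mset_eq_conv)
      moreover from 1 have "set_mset (?lo (image_mset ((+) m) \<sigma>)) = {}"
        by (auto simp: raised_parts_def)
      then have "?lo (image_mset ((+) m) \<sigma>) = {#}"
        by (simp only: set_mset_eq_empty_iff)
      moreover have "image_mset (\<lambda>i. i - m) (image_mset ((+) m) \<sigma>) = \<sigma>"
        by (simp add: multiset.map_comp comp_def)
      ultimately show ?case
        by (simp only: prod.case filter_union_mset add_0_left add_0_right)
    qed
    show "\<forall>\<pi>\<in>{\<pi>. partition_of l \<pi>}. ?f (?g \<pi>) = \<pi>"
      using fg by blast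
    show "?f ` ?S \<subseteq> {\<pi>. partition_of l \<pi>}"
      by (auto simp: bounded_parts_def raised_parts_def partition_of_def sum_mset_image_add)
    show "?g ` {\<pi>. partition_of l \<pi>} \<subseteq> ?S"
    proof (rule image_subsetI)
      fix \<pi> assume "\<pi> \<in> {\<pi>. partition_of l \<pi>}"
      then have \<pi>: "partition_of l \<pi>" by simp
      then have "sum_mset (?f (?g \<pi>)) = l"
        using fg[of \<pi>] by (simp only: partition_of_def)
      with \<pi> show "?g \<pi> \<in> ?S"
        by (auto simp: bounded_parts_def raised_parts_def partition_of_def sum_mset_image_add)
    qed
  qed
  then have "num_partitions l = card ?S"
    unfolding num_partitions_def by (rule bij_betw_same_card[symmetric])
  also have "\<dots> = (\<Sum>j\<le>l. card (bounded_parts m j) * card (raised_parts m (l - j)))"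
    by (simp add: finite_bounded_parts finite_raised_parts card_cartesian_product)
  finally show ?thesis .
qed

text \<open>Copartitions are classified by the number \<open>m\<close> of parts of \<open>\<gamma>\<close> and the excess \<open>j\<close> of its size
  over \<open>m\<close>.\<close>
lemma cp111_split:
  "cp111 n = (\<Sum>m\<le>n. \<Sum>j\<le>n - m. card (exact_parts m j) * card (raised_parts m (n - m - j)))"
proof -
  let ?S = "SIGMA m:{..n}. SIGMA j:{..n - m}. exact_parts m j \<times> raised_parts m (n - m - j)"
  let ?C = "{c. copartition111 c \<and> copartition_size c = n}"
  \<comment> \<open>Parts of size 0 are not admitted, hence the empty partition for \<open>m = 0\<close>.\<close>
  let ?rho = "\<lambda>m \<sigma>. if m = 0 then {#} else replicate_mset (size \<sigma>) m"
  let ?f = "\<lambda>(m :: nat, j :: nat, \<gamma>, \<sigma> :: nat multiset). (\<gamma> :: nat multiset, ?rho m \<sigma>, \<sigma>)"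
  let ?g = "\<lambda>(\<gamma>, \<rho> :: nat multiset, \<sigma> :: nat multiset).
    (size \<gamma>, sum_mset \<gamma> - size \<gamma>, \<gamma> :: nat multiset, \<sigma>)"
  have size_le: "size \<gamma> \<le> sum_mset \<gamma>" if "\<forall>i\<in>#\<gamma>. 0 < i" for \<gamma> :: "nat multiset"
    using that by (induction \<gamma>) auto
  have rho: "\<rho> = ?rho (size \<gamma>) \<sigma>" if "copartition111 (\<gamma>, \<rho>, \<sigma>)" for \<gamma> \<rho> \<sigma>
  proof (cases "\<gamma> = {#}")
    case False
    with that have "size \<rho> = size \<sigma>" "set_mset \<rho> \<subseteq> {size \<gamma>}"
      by (auto simp: copartition111_def)
    with False show ?thesis
      using set_mset_subset_singletonD[of \<rho> "size \<gamma>"] by auto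
  qed (use that in \<open>simp add: copartition111_def\<close>)
  have sum_rho: "sum_mset (?rho m \<sigma>) = m * size \<sigma>" for m :: nat and \<sigma> :: "nat multiset"
    by simp
  have "bij_betw ?f ?S ?C"
  proof (rule bij_betw_byWitness[where f' = ?g])
    show "\<forall>s\<in>?S. ?g (?f s) = s"
      by (auto simp: exact_parts_def partition_of_def)
    show "\<forall>c\<in>?C. ?f (?g c) = c"
      using rho by fastforce
    show "?f ` ?S \<subseteq> ?C"
    proof (rule image_subsetI)
      fix s assume "s \<in> ?S"
      then obtain m j \<gamma> \<sigma> where s: "s = (m, j, \<gamma>, \<sigma>)" and "m \<le> n" "j \<le> n - m"
        "\<gamma> \<in> exact_parts m j" "\<sigma> \<in> raised_parts m (n - m - j)" by auto
      note mem = this(2-)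
      then have "copartition111 (\<gamma>, ?rho m \<sigma>, \<sigma>)"
        by (auto simp: copartition111_def is_partition_def partition_of_def exact_parts_def
            raised_parts_def)
      moreover from mem have "copartition_size (\<gamma>, ?rho m \<sigma>, \<sigma>) = n"
        unfolding copartition_size_def prod.case sum_rho
        by (auto simp: partition_of_def exact_parts_def raised_parts_def)
      ultimately show "?f s \<in> ?C" by (simp add: s)
    qed
    show "?g ` ?C \<subseteq> ?S"
    proof (rule image_subsetI)
      fix c assume "c \<in> ?C"
      then obtain \<gamma> \<rho> \<sigma> where c: "c = (\<gamma>, \<rho>, \<sigma>)" and cop: "copartition111 (\<gamma>, \<rho>, \<sigma>)"
        and sz: "copartition_size (\<gamma>, \<rho>, \<sigma>) = n"
        by (cases c) auto
      have pos: "\<forall>i\<in>#\<gamma>. 0 < i" "\<forall>i\<in>#\<sigma>. 0 < i"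
        using cop by (auto simp: copartition111_def is_partition_def partition_of_def)
      have "sum_mset \<rho> = size \<gamma> * size \<sigma>"
        using rho[OF cop] sum_rho by metis
      then have "sum_mset \<gamma> + size \<gamma> * size \<sigma> + sum_mset \<sigma> = n"
        using sz by (simp add: copartition_size_def)
      with pos size_le[OF pos(1)] show "?g c \<in> ?S"
        unfolding c
        by (auto simp: exact_parts_def raised_parts_def partition_of_def)
    qed
  qed
  then have "cp111 n = card ?S"
    unfolding cp111_def by (rule bij_betw_same_card[symmetric])
  also have "\<dots> = (\<Sum>m\<le>n. \<Sum>j\<le>n - m. card (exact_parts m j) * card (raised_parts m (n - m - j)))"
    by (simp add: finite_exact_parts finite_raised_parts card_cartesian_product finite_SigmaI)
  finally show ?thesis .
qed

theorem theorem4p5: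
  fixes n :: nat
  shows "cp111 n = (\<Sum>k = 0..n. num_partitions k)"
proof -
  have "cp111 n = (\<Sum>m\<le>n. num_partitions (n - m))"
    by (simp only: cp111_split card_exact_eq_card_bounded num_partitions_split[symmetric])
  also have "\<dots> = (\<Sum>k = 0..n. num_partitions k)"
    by (simp add: atLeast0AtMost[symmetric] sum.atLeastAtMost_rev[of num_partitions 0 n])
  finally show ?thesis .
qed

end
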